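(* Let $A=(a(1),\dots,a(n))$ be a $d\times n$ matrix with rational entries such that $(a(1),\dots,a(d))$ is the identity matrix and: (1) for $j=d+1,\dots,n-1$, $a(j)$ has all coordinates positive and $|a(j)|<1$; (2) $a(n)$ has all coordinates positive and $|a(n)|>1$. Let $\beta\in\mathbb{C}^d$ with $\Re\beta_k<0$ for all $k=1,\dots,d$. Let $y_{n,0}\in\mathbb{C}^*$, $p\in\mathbb{Z}^d$, and let $\delta\in\mathbb{R}^d$ with $|\delta_k|<1/2$ for all $k$ be such that $y_{n,0}\in S_{p,\delta}$. Then there is an asymptotic expansion with respect to the variable $y_n$ in the open sector $S_{p,\delta}$: $$F_{p,\delta}(\beta;y)\ \underset{y_n\to0}{\sim}\ \sum_{m\in\mathbb{N}}A_{p,\delta}(\beta;m,y')\frac{y_n^m}{m!},$$ where $y'=(y_{d+1},\dots,y_{n-1})$ and $$A_{p,\delta}(\beta;m,y')=\int_{D_{p,\delta}}t^{-\beta-\mathbf 1+m\,a(n)}\exp\Big(t_1+\cdots+t_d+\sum_{j=d+1}^{n-1}y_jt^{a(j)}\Big)dt .$$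
   Context: Notation: $\mathbb{N}$ contains $0$; $\mathbf 1=(1,\dots,1)\in\mathbb{N}^d$; $|a|=a_1+\cdots+a_d$ for $a\in\mathbb{Q}^d$; $\langle u,v\rangle=\sum_k u_kv_k$. The universal covering of $(\mathbb{C}^* )^d$ has coordinates $(r,\theta)$, $r_k=|t_k|>0$, $\theta_k=\arg t_k\in\mathbb{R}$, and $t^v=\exp\big(\sum_kv_k(\log r_k+\sqrt{-1}\,\theta_k)\big)$ for $v\in\mathbb{C}^d$. For $p\in\mathbb{Z}^d$ and $\delta\in\mathbb{R}^d$ with $|\delta_k|<1/2$, $D_{p,\delta}$ is the set of points of this covering with $\arg t_k=(1+\delta_k+2p_k)\pi$ for $k=1,\dots,d$, parametrized (and oriented) by $(r_1,\dots,r_d)\in\mathbb{R}_{>0}^d$. For $y=(y_{d+1},\dots,y_n)$, $$F_{p,\delta}(\beta;y)=\int_{D_{p,\delta}}t^{-\beta-\mathbf 1}\exp\Big(t_1+\cdots+t_d+\sum_{j=d+1}^ny_jt^{a(j)}\Big)dt .$$ Let $\Theta=\,]\pi/2,3\pi/2[\,+2\pi\mathbb{Z}$ and let $S_{p,\delta}\subset\mathbb{C}^*$ be the open sector of those $y_n$ with $\arg y_n+\langle\mathbf 1+\delta+2p,a(n)\rangle\pi\in\Theta$ (i.e. $\Re(y_nt^{a(n)})<0$ along $D_{p,\delta}$). Here $y'\in\mathbb{C}^{n-d-1}$ and $y_n\in S_{p,\delta}$. The asymptotic expansion means: for every integer $N>0$ there is $K_N=K_N(\beta,y')>0$ such that $\big|F_{p,\delta}(\beta;y)-\sum_{m=0}^{N-1}A_{p,\delta}(\beta;m,y')\frac{y_n^m}{m!}\big|\le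 K_N|y_n|^N$ for every $y_n\in S_{p,\delta}$. *)

theory Defs
  imports "HOL-Analysis.Analysis"
begin

text \<open>
  Vectors of length \<open>d\<close> are functions on \<open>nat\<close> of which only the values on \<open>{1..d}\<close> matter.
  A matrix is given by its columns: \<open>a j k\<close> is the \<open>k\<close>-th coordinate of the column \<open>a(j)\<close>.
  A point of the universal covering of the \<open>d\<close>-fold product of the punctured plane is given
  by its coordinates \<open>r\<close> (moduli) and \<open>\<theta>\<close> (arguments).
\<close>

definition weight :: "nat \<Rightarrow> (nat \<Rightarrow> rat) \<Rightarrow> rat" where
  "weight d v = (\<Sum>k = 1..d. v k)"

definition cover_pow :: "nat \<Rightarrow> (nat \<Rightarrow> real) \<Rightarrow> (nat \<Rightarrow> real) \<Rightarrow> (nat \<Rightarrow> complex) \<Rightarrow> complex" where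
  "cover_pow d r \<theta> v =
     exp (\<Sum>k = 1..d. v k * (complex_of_real (ln (r k)) + \<i> * complex_of_real (\<theta> k)))"

definition cycle_arg :: "(nat \<Rightarrow> int) \<Rightarrow> (nat \<Rightarrow> real) \<Rightarrow> nat \<Rightarrow> real" where
  "cycle_arg p \<delta> k = (1 + \<delta> k + 2 * of_int (p k)) * pi"

text \<open>
  Integration over the cycle \<open>D\<close> of points with arguments \<^term>\<open>cycle_arg p \<delta>\<close>, parametrized
  and oriented by the moduli: there \<open>t\<^sub>k = r\<^sub>k cis \<theta>\<^sub>k\<close> with \<open>\<theta>\<^sub>k\<close> constant, whence
  \<open>dt = (\<Prod>k. cis \<theta>\<^sub>k) dr\<^sub>1 \<dots> dr\<^sub>d\<close>. As the Bochner integral of a non-integrable function is \<open>0\<close>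
  by convention, (absolute) convergence is expressed by a separate predicate.
\<close>

definition cycle_form ::
  "nat \<Rightarrow> (nat \<Rightarrow> int) \<Rightarrow> (nat \<Rightarrow> real) \<Rightarrow>
   ((nat \<Rightarrow> real) \<Rightarrow> (nat \<Rightarrow> real) \<Rightarrow> complex) \<Rightarrow> (nat \<Rightarrow> real) \<Rightarrow> complex" where
  "cycle_form d p \<delta> g r = g r (cycle_arg p \<delta>) * (\<Prod>k = 1..d. cis (cycle_arg p \<delta> k))"

definition cycle_integrable ::
  "nat \<Rightarrow> (nat \<Rightarrow> int) \<Rightarrow> (nat \<Rightarrow> real) \<Rightarrow>
   ((nat \<Rightarrow> real) \<Rightarrow> (nat \<Rightarrow> real) \<Rightarrow> complex) \<Rightarrow> bool" where
  "cycle_integrable d p \<delta> g \<longleftrightarrow>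
     set_integrable (Pi\<^sub>M {1..d} (\<lambda>_. lborel)) (Pi\<^sub>E {1..d} (\<lambda>_. {0<..})) (cycle_form d p \<delta> g)"

definition cycle_integral ::
  "nat \<Rightarrow> (nat \<Rightarrow> int) \<Rightarrow> (nat \<Rightarrow> real) \<Rightarrow>
   ((nat \<Rightarrow> real) \<Rightarrow> (nat \<Rightarrow> real) \<Rightarrow> complex) \<Rightarrow> complex" where
  "cycle_integral d p \<delta> g =
     set_lebesgue_integral (Pi\<^sub>M {1..d} (\<lambda>_. lborel)) (Pi\<^sub>E {1..d} (\<lambda>_. {0<..})) (cycle_form d p \<delta> g)"

definition F_integrand ::
  "nat \<Rightarrow> nat \<Rightarrow> (nat \<Rightarrow> nat \<Rightarrow> rat) \<Rightarrow> (nat \<Rightarrow> complex) \<Rightarrow> (nat \<Rightarrow> complex) \<Rightarrow>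
   (nat \<Rightarrow> real) \<Rightarrow> (nat \<Rightarrow> real) \<Rightarrow> complex" where
  "F_integrand d n a \<beta> y r \<theta> =
     cover_pow d r \<theta> (\<lambda>k. - \<beta> k - 1) *
     exp ((\<Sum>k = 1..d. rcis (r k) (\<theta> k)) +
          (\<Sum>j = d+1..n. y j * cover_pow d r \<theta> (\<lambda>k. of_rat (a j k))))"

definition A_integrand ::
  "nat \<Rightarrow> nat \<Rightarrow> (nat \<Rightarrow> nat \<Rightarrow> rat) \<Rightarrow> (nat \<Rightarrow> complex) \<Rightarrow> nat \<Rightarrow> (nat \<Rightarrow> complex) \<Rightarrow>
   (nat \<Rightarrow> real) \<Rightarrow> (nat \<Rightarrow> real) \<Rightarrow> complex" where
  "A_integrand d n a \<beta> m y r \<theta> =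
     cover_pow d r \<theta> (\<lambda>k. - \<beta> k - 1 + of_nat m * of_rat (a n k)) *
     exp ((\<Sum>k = 1..d. rcis (r k) (\<theta> k)) +
          (\<Sum>j = d+1..n-1. y j * cover_pow d r \<theta> (\<lambda>k. of_rat (a j k))))"

definition F_int ::
  "nat \<Rightarrow> nat \<Rightarrow> (nat \<Rightarrow> nat \<Rightarrow> rat) \<Rightarrow> (nat \<Rightarrow> int) \<Rightarrow> (nat \<Rightarrow> real) \<Rightarrow>
   (nat \<Rightarrow> complex) \<Rightarrow> (nat \<Rightarrow> complex) \<Rightarrow> complex" where
  "F_int d n a p \<delta> \<beta> y = cycle_integral d p \<delta> (F_integrand d n a \<beta> y)"

definition A_coeff ::
  "nat \<Rightarrow> nat \<Rightarrow> (nat \<Rightarrow> nat \<Rightarrow> rat) \<Rightarrow> (nat \<Rightarrow> int) \<Rightarrow> (nat \<Rightarrow> real) \<Rightarrow>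
   (nat \<Rightarrow> complex) \<Rightarrow> nat \<Rightarrow> (nat \<Rightarrow> complex) \<Rightarrow> complex" where
  "A_coeff d n a p \<delta> \<beta> m y = cycle_integral d p \<delta> (A_integrand d n a \<beta> m y)"

definition Theta :: "real set" where
  "Theta = (\<Union>l::int. {pi/2 + 2 * pi * of_int l <..< 3 * pi/2 + 2 * pi * of_int l})"

text \<open>
  Any other choice of the argument gives the same sector, \<^const>\<open>Theta\<close> being
  \<open>2\<pi>\<close>-periodic.
\<close>

definition sector ::
  "nat \<Rightarrow> nat \<Rightarrow> (nat \<Rightarrow> nat \<Rightarrow> rat) \<Rightarrow> (nat \<Rightarrow> int) \<Rightarrow> (nat \<Rightarrow> real) \<Rightarrow> complex set" where
  "sector d n a p \<delta> =
     {z. z \<noteq> 0 \<and>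
         Arg z + (\<Sum>k = 1..d. (1 + \<delta> k + 2 * of_int (p k)) * of_rat (a n k)) * pi \<in> Theta}"

text \<open>
  The expansion \<open>f(z) \<sim> (\<Sum>m. c\<^sub>m z^m / m!)\<close> as \<open>z \<rightarrow> 0\<close>, with remainder bounds valid
  on all of \<open>S\<close>.
\<close>

definition has_asymptotic_expansion ::
  "(complex \<Rightarrow> complex) \<Rightarrow> complex set \<Rightarrow> (nat \<Rightarrow> complex) \<Rightarrow> bool" where
  "has_asymptotic_expansion f S c \<longleftrightarrow>
     (\<forall>N>0. \<exists>K>0. \<forall>z\<in>S.
        norm (f z - (\<Sum>m<N. c m * (z ^ m / fact m))) \<le> K * norm z ^ N)"

end

theory Submission imports Defs
begin

text \<open>
  Along the cycle the real part of \<open>t\<^sub>1 + \<dots> + t\<^sub>d\<close> is \<open>- (\<Sum>k. cos (\<delta>\<^sub>k \<pi>) r\<^sub>k)\<close>, and the terms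
  \<open>y\<^sub>j t^a(j)\<close> with \<open>|a(j)| < 1\<close> are of lower order in \<open>r\<^sub>1 + \<dots> + r\<^sub>d\<close>; so the integrand of
  the \<open>m\<close>-th coefficient is dominated by a product of Gamma kernels. On the sector
  \<open>Re (y\<^sub>n t^a(n)) < 0\<close>, and there the Taylor remainder of \<open>exp\<close> of order \<open>N\<close> is at most
  \<open>|y\<^sub>n t^a(n)|^N / (N-1)!\<close>. Integrating it against the integrand for \<open>m = 0\<close> gives
  \<open>|y\<^sub>n|^N / (N-1)!\<close> times the integral of the absolute value of the integrand for \<open>m = N\<close>.
\<close>

section \<open>Taylor remainder of \<open>exp\<close> and integrability of Gamma kernels\<close>

text \<open>The left half-plane is convex, contains 0, and every derivative of \<open>exp\<close>
  has modulus at most 1 there, so the complex Taylor estimate applies with constant 1. For a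
  polynomial of degree N - 1 that estimate divides by (N - 1)!, which is where this factorial comes
  from.\<close>

lemma norm_exp_minus_Taylor_le:
  fixes z :: complex
  assumes z: "Re z \<le> 0" and N: "N > 0"
  shows "norm (exp z - (\<Sum>m<N. z ^ m / fact m)) \<le> norm z ^ N / fact (N - 1)"
proof -
  obtain n where n: "N = Suc n"
    using N by (cases N) auto
  have conv: "convex {w. Re w \<le> 0}"
    using convex_halfspace_Re_le[of 0] .
  have "norm (exp z - (\<Sum>i\<le>n. exp 0 * (z - 0) ^ i / fact i)) \<le> 1 * norm (z - 0) ^ Suc n / fact n"
    by (rule complex_Taylor[where f = "\<lambda>_. exp" and S = "{w. Re w \<le> 0}", OF conv])
       (use z in \<open>auto intro!: derivative_eq_intros\<close>)
  then show ?thesis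
    by (simp add: n lessThan_Suc_atMost)
qed

text \<open>The kernel is the modulus of the integrand of Euler's Gamma integral rescaled by
  \<open>c\<close>, which converges absolutely.\<close>

lemma integrable_Gamma_kernel:
  fixes s c :: real
  assumes "s > 0" "c > 0"
  shows "integrable lborel (\<lambda>x. indicator {0<..} x * (x powr (s - 1) * exp (- c * x)))"
proof -
  have "set_integrable lebesgue {0<..}
      (\<lambda>t. norm (complex_of_real t powr (complex_of_real s - 1) / of_real (exp (c * t))))"
    using assms by (intro set_integrable_norm absolutely_integrable_Gamma_integral) auto
  also have "?this \<longleftrightarrow> set_integrable lebesgue {0<..} (\<lambda>x. x powr (s - 1) * exp (- c * x))"
    by (intro set_integrable_cong refl)
       (auto simp: norm_divide norm_powr_real_powr exp_minus field_simps simp flip: of_real_diff)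
  \<comment> \<open>\<open>lebesgue\<close> is the completion of \<open>lborel\<close>, and a Borel
    function is integrable for both or for neither.\<close>
  finally show ?thesis
    by (subst (asm) set_integrable_def) (simp add: integrable_completion)
qed

text \<open>Fubini: the variables separate, so one-dimensional integrability suffices.\<close>

lemma integrable_prod_Gamma_kernel:
  fixes s c :: "nat \<Rightarrow> real"
  assumes "\<And>k. k \<in> {1..d} \<Longrightarrow> s k > 0" "\<And>k. k \<in> {1..d} \<Longrightarrow> c k > 0"
  shows "set_integrable (Pi\<^sub>M {1..d} (\<lambda>_. lborel)) (Pi\<^sub>E {1..d} (\<lambda>_. {0<..}))
    (\<lambda>r. \<Prod>k = 1..d. r k powr (s k - 1) * exp (- c k * r k))"
proof -
  interpret product_sigma_finite "\<lambda>_::nat. lborel :: real measure" ..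
  have "integrable (Pi\<^sub>M {1..d} (\<lambda>_. lborel))
      (\<lambda>r. \<Prod>k = 1..d. indicator {0<..} (r k) * (r k powr (s k - 1) * exp (- c k * r k)))"
    using assms by (intro product_integrable_prod integrable_Gamma_kernel) auto
  also have "?this \<longleftrightarrow> ?thesis"
    unfolding set_integrable_def
  proof (intro Bochner_Integration.integrable_cong refl)
    fix r :: "nat \<Rightarrow> real" assume "r \<in> space (Pi\<^sub>M {1..d} (\<lambda>_. lborel))"
    \<comment> \<open>The indicator of the orthant is a product over the coordinates only at
      extensional \<open>r\<close>, and the space of the product measure consists of those.\<close>
    then have "r \<in> extensional {1..d}"
      by (auto simp: space_PiM PiE_def)
    then have "(\<Prod>k = 1..d. indicator {0<..} (r k)) = (indicator (Pi\<^sub>E {1..d} (\<lambda>_. {0<..})) r :: real)"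
      by (auto simp: indicator_def PiE_def Pi_def prod_zero_iff)
    then show "(\<Prod>k = 1..d. indicator {0<..} (r k) * (r k powr (s k - 1) * exp (- c k * r k))) =
        indicator (Pi\<^sub>E {1..d} (\<lambda>_. {0<..})) r *\<^sub>R (\<Prod>k = 1..d. r k powr (s k - 1) * exp (- c k * r k))"
      by (simp add: prod.distrib)
  qed
  finally show ?thesis .
qed

section \<open>Moduli of powers on the covering and growth of the lower-order monomials\<close>

lemma of_rat_complex_eq: "(of_rat q :: complex) = complex_of_real (of_rat q)"
  by (cases q) (simp add: of_rat_rat)

text \<open>The arguments enter only through the imaginary parts of \<open>v\<close>. On the cycle
  they are fixed, so the first factor is a constant there.\<close>

lemma norm_cover_pow:
  assumes "\<forall>k\<in>{1..d}. r k > 0"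
  shows "norm (cover_pow d r \<theta> v) =
    exp (- (\<Sum>k = 1..d. Im (v k) * \<theta> k)) * (\<Prod>k = 1..d. r k powr Re (v k))"
proof -
  have "(\<Prod>k = 1..d. r k powr Re (v k)) = exp (\<Sum>k = 1..d. Re (v k) * ln (r k))"
    unfolding exp_sum[OF finite_atLeastAtMost]
  proof (intro prod.cong refl)
    fix k assume "k \<in> {1..d}"
    with assms have "r k > 0" by blast
    then show "r k powr Re (v k) = exp (Re (v k) * ln (r k))"
      by (simp add: powr_def)
  qed
  then show ?thesis
    by (simp add: cover_pow_def sum_subtractf flip: exp_add)
qed

lemma norm_cover_pow_rat:
  assumes "\<forall>k\<in>{1..d}. r k > 0"
  shows "norm (cover_pow d r \<theta> (\<lambda>k. of_rat (v k))) = (\<Prod>k = 1..d. r k powr of_rat (v k))"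
  using norm_cover_pow[OF assms, where v = "\<lambda>k. of_rat (v k)"]
  by (simp add: of_rat_complex_eq)

text \<open>Used to write the integrand of the m-th coefficient as the one for 0 times the m-th
  power of t^a(n).\<close>

lemma cover_pow_add_mult:
  "cover_pow d r \<theta> (\<lambda>k. v k + of_nat m * w k) = cover_pow d r \<theta> v * cover_pow d r \<theta> w ^ m"
  unfolding cover_pow_def exp_of_nat_mult[symmetric] exp_add[symmetric]
  by (simp add: sum_distrib_left sum.distrib[symmetric] algebra_simps)

text \<open>For \<open>x\<close> beyond \<open>(y/\<epsilon>) powr (1/(1-w))\<close> the linear term dominates; before that
  the left-hand side is bounded by its value at this point.\<close>
lemma powr_le_linear_plus_const:
  fixes w y \<epsilon> x :: real
  assumes "0 < w" "w < 1" "0 \<le> y" "0 < \<epsilon>" "0 < x"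
  shows "y * x powr w \<le> \<epsilon> * x + y * (y / \<epsilon>) powr (w / (1 - w))"
proof (cases "x powr (1 - w) \<ge> y / \<epsilon>")
  case True
  then have "y * x powr w \<le> (\<epsilon> * x powr (1 - w)) * x powr w"
    using assms by (intro mult_right_mono) (auto simp: field_simps)
  also have "\<dots> = \<epsilon> * x"
    using assms by (simp add: mult.assoc flip: powr_add)
  finally show ?thesis
    using assms by (simp add: add_increasing2)
next
  case False
  have "x powr w = (x powr (1 - w)) powr (w / (1 - w))"
    using assms by (simp add: powr_powr)
  also have "\<dots> \<le> (y / \<epsilon>) powr (w / (1 - w))"
    using False assms by (intro powr_mono2) auto
  finally have "y * x powr w \<le> y * (y / \<epsilon>) powr (w / (1 - w))"
    using assms by (intro mult_left_mono) auto
  then show ?thesis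
    using assms by (simp add: add_increasing)
qed

text \<open>Each \<open>r k\<close> is at most the total, and the exponents are nonnegative. This
  reduces a monomial in d variables to a power of the single variable r_1 + ... + r_d.\<close>

lemma prod_powr_le_sum_powr:
  fixes r v :: "'a \<Rightarrow> real"
  assumes "finite A" "A \<noteq> {}" "\<And>k. k \<in> A \<Longrightarrow> r k > 0" "\<And>k. k \<in> A \<Longrightarrow> v k \<ge> 0"
  shows "(\<Prod>k\<in>A. r k powr v k) \<le> (\<Sum>k\<in>A. r k) powr (\<Sum>k\<in>A. v k)"
proof -
  have pos: "(\<Sum>k\<in>A. r k) > 0"
    using assms by (intro sum_pos) auto
  have "r k powr v k \<le> (\<Sum>k\<in>A. r k) powr v k" if "k \<in> A" for k
  proof (rule powr_mono2)
    show "r k \<le> (\<Sum>k\<in>A. r k)"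
      using that assms by (intro member_le_sum) (simp_all add: less_imp_le)
  qed (use that assms in \<open>simp_all add: less_imp_le\<close>)
  then have "(\<Prod>k\<in>A. r k powr v k) \<le> (\<Prod>k\<in>A. (\<Sum>k\<in>A. r k) powr v k)"
    by (intro prod_mono) simp
  also have "\<dots> = (\<Sum>k\<in>A. r k) powr (\<Sum>k\<in>A. v k)"
    using pos by (subst powr_sum) auto
  finally show ?thesis .
qed

lemma lower_order_terms_le:
  fixes a :: "nat \<Rightarrow> nat \<Rightarrow> rat" and y :: "nat \<Rightarrow> complex" and \<epsilon> :: real
  assumes "1 \<le> d" "finite J" "\<epsilon> > 0"
    and a: "\<forall>j\<in>J. (\<forall>k\<in>{1..d}. a j k > 0) \<and> weight d (a j) < 1"
  shows "\<exists>C. \<forall>r \<theta>. (\<forall>k\<in>{1..d}. r k > 0) \<longrightarrow>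
    Re (\<Sum>j\<in>J. y j * cover_pow d r \<theta> (\<lambda>k. of_rat (a j k))) \<le> \<epsilon> * (\<Sum>k = 1..d. r k) + C"
proof -
  \<comment> \<open>Each index in \<open>J\<close> receives an equal share of \<epsilon>; the added
    1 avoids division by 0 when \<open>J\<close> is empty, that is, for n = d + 1 in the
    application.\<close>
  define \<eta> where "\<eta> = \<epsilon> / (card J + 1)"
  have \<eta>: "\<eta> > 0" "card J * \<eta> \<le> \<epsilon>"
    using \<open>\<epsilon> > 0\<close> by (auto simp: \<eta>_def field_simps)
  define w :: "nat \<Rightarrow> real" where "w j = of_rat (weight d (a j))" for j
  \<comment> \<open>The sum of the constants of \<open>powr_le_linear_plus_const\<close>, taken with
    \<eta> for \<epsilon>; it depends on neither \<open>r\<close> nor the arguments.\<close>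
  define C where "C = (\<Sum>j\<in>J. norm (y j) * (norm (y j) / \<eta>) powr (w j / (1 - w j)))"
  show ?thesis
  proof (intro exI[of _ C] allI impI)
    fix r \<theta> :: "nat \<Rightarrow> real" assume r: "\<forall>k\<in>{1..d}. r k > 0"
    define R where "R = (\<Sum>k = 1..d. r k)"
    have R: "R > 0"
      unfolding R_def using r \<open>1 \<le> d\<close> by (intro sum_pos) auto
    have term_le: "norm (y j * cover_pow d r \<theta> (\<lambda>k. of_rat (a j k)))
        \<le> \<eta> * R + norm (y j) * (norm (y j) / \<eta>) powr (w j / (1 - w j))" if "j \<in> J" for j
    proof -
      have w: "0 < w j" "w j < 1"
        using a that \<open>1 \<le> d\<close> by (auto simp: w_def weight_def intro!: sum_pos)
      have "w j = (\<Sum>k = 1..d. of_rat (a j k))"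
        by (simp add: w_def weight_def of_rat_sum)
      then have "(\<Prod>k = 1..d. r k powr of_rat (a j k)) \<le> R powr w j"
        unfolding R_def using a that r \<open>1 \<le> d\<close>
        by (simp only:, intro prod_powr_le_sum_powr) (auto intro: less_imp_le)
      then have "norm (y j * cover_pow d r \<theta> (\<lambda>k. of_rat (a j k))) \<le> norm (y j) * R powr w j"
        unfolding norm_mult norm_cover_pow_rat[OF r] by (intro mult_left_mono) auto
      also have "\<dots> \<le> \<eta> * R + norm (y j) * (norm (y j) / \<eta>) powr (w j / (1 - w j))"
        using w \<eta> R by (intro powr_le_linear_plus_const) auto
      finally show ?thesis .
    qed
    have "Re (\<Sum>j\<in>J. y j * cover_pow d r \<theta> (\<lambda>k. of_rat (a j k)))
        \<le> (\<Sum>j\<in>J. norm (y j * cover_pow d r \<theta> (\<lambda>k. of_rat (a j k))))"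
      by (rule order.trans[OF complex_Re_le_cmod norm_sum])
    also have "\<dots> \<le> (\<Sum>j\<in>J. \<eta> * R + norm (y j) * (norm (y j) / \<eta>) powr (w j / (1 - w j)))"
      by (intro sum_mono term_le)
    also have "\<dots> = (card J * \<eta>) * R + C"
      by (simp add: sum.distrib C_def)
    also have "\<dots> \<le> \<epsilon> * R + C"
      using \<eta> R by (intro add_right_mono mult_right_mono) auto
    finally show "Re (\<Sum>j\<in>J. y j * cover_pow d r \<theta> (\<lambda>k. of_rat (a j k))) \<le> \<epsilon> * (\<Sum>k = 1..d. r k) + C"
      by (simp add: R_def)
  qed
qed

section \<open>Absolute convergence of the coefficient integrals\<close>

lemma cos_cycle_arg: "cos (cycle_arg p \<delta> k) = - cos (\<delta> k * pi)"
proof -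
  have "cycle_arg p \<delta> k = (\<delta> k * pi + pi) + of_int (p k) * (2 * pi)"
    by (simp add: cycle_arg_def algebra_simps)
  then have "cos (cycle_arg p \<delta> k) = cos (\<delta> k * pi + pi)"
    using sin_cos_eq_iff[of "cycle_arg p \<delta> k" "\<delta> k * pi + pi"] by (auto simp: mult.commute)
  then show ?thesis by simp
qed

lemma cover_pow_measurable [measurable]:
  "(\<lambda>r. cover_pow d r \<theta> v) \<in> borel_measurable (Pi\<^sub>M {1..d} (\<lambda>_. lborel))"
  unfolding cover_pow_def by measurable

lemma positive_orthant_measurable [measurable]:
  "Pi\<^sub>E {1..d} (\<lambda>_. {0<..}) \<in> sets (Pi\<^sub>M {1..d} (\<lambda>_::nat. lborel :: real measure))"
  by (intro sets_PiM_I_finite) auto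

lemma cycle_form_A_measurable:
  "set_borel_measurable (Pi\<^sub>M {1..d} (\<lambda>_. lborel)) (Pi\<^sub>E {1..d} (\<lambda>_. {0<..}))
     (cycle_form d p \<delta> (A_integrand d n a \<beta> m y))"
  unfolding set_borel_measurable_def cycle_form_def A_integrand_def rcis_def
  by measurable

lemma cycle_form_F_measurable:
  "set_borel_measurable (Pi\<^sub>M {1..d} (\<lambda>_. lborel)) (Pi\<^sub>E {1..d} (\<lambda>_. {0<..}))
     (cycle_form d p \<delta> (F_integrand d n a \<beta> y))"
  unfolding set_borel_measurable_def cycle_form_def F_integrand_def rcis_def
  by measurable

lemma norm_cycle_form: "norm (cycle_form d p \<delta> g r) = norm (g r (cycle_arg p \<delta>))"
  by (simp add: cycle_form_def norm_mult flip: prod_norm)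

lemma cycle_integrable_A:
  fixes a :: "nat \<Rightarrow> nat \<Rightarrow> rat"
  assumes "1 \<le> d"
    and a: "\<forall>j\<in>{d+1..n-1}. (\<forall>k\<in>{1..d}. a j k > 0) \<and> weight d (a j) < 1"
    and an: "\<forall>k\<in>{1..d}. a n k > 0"
    and \<beta>: "\<And>k. k \<in> {1..d} \<Longrightarrow> Re (\<beta> k) < 0"
    and \<delta>: "\<And>k. k \<in> {1..d} \<Longrightarrow> \<bar>\<delta> k\<bar> < 1/2"
  shows "cycle_integrable d p \<delta> (A_integrand d n a \<beta> m y)"
proof -
  define \<theta> where "\<theta> = cycle_arg p \<delta>"
  define c where "c k = cos (\<delta> k * pi)" for k
  \<comment> \<open>Half of the smallest decay rate: the linear terms decay at rate at least
    \<open>2 * \<epsilon>\<close>, of which one \<epsilon> absorbs the lower-order terms and the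
    other remains in the Gamma kernel.\<close>
  define \<epsilon> where "\<epsilon> = Min (c ` {1..d}) / 2"
  have c_pos: "c k > 0" if "k \<in> {1..d}" for k
  proof -
    have "- (1/2) * pi < \<delta> k * pi" "\<delta> k * pi < 1/2 * pi"
      using \<delta>[OF that] by (intro mult_strict_right_mono; simp)+
    then show ?thesis
      unfolding c_def by (intro cos_gt_zero_pi) auto
  qed
  have \<epsilon>_pos: "\<epsilon> > 0"
    using c_pos \<open>1 \<le> d\<close> by (auto simp: \<epsilon>_def)
  have \<epsilon>_le: "2 * \<epsilon> \<le> c k" if "k \<in> {1..d}" for k
    using that by (auto simp: \<epsilon>_def)
  obtain C where C: "\<And>r \<theta>. \<forall>k\<in>{1..d}. r k > 0 \<Longrightarrow>
    Re (\<Sum>j\<in>{d+1..n-1}. y j * cover_pow d r \<theta> (\<lambda>k. of_rat (a j k))) \<le> \<epsilon> * (\<Sum>k = 1..d. r k) + C"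
    using lower_order_terms_le[where y = y, OF \<open>1 \<le> d\<close> finite_atLeastAtMost \<epsilon>_pos a] by blast
  define v where "v k = - \<beta> k - 1 + of_nat m * of_rat (a n k)" for k
  \<comment> \<open>The parameter of the k-th Gamma kernel: the modulus of the power contains
    \<open>r k\<close> to the exponent \<open>s k - 1\<close>.\<close>
  define s where "s k = - Re (\<beta> k) + m * of_rat (a n k)" for k
  have s_pos: "s k > 0" if "k \<in> {1..d}" for k
  proof -
    have "of_rat (a n k) > (0::real)"
      using an that by simp
    then show ?thesis
      using \<beta>[OF that] unfolding s_def by (intro add_pos_nonneg mult_nonneg_nonneg) auto
  qed
  have Re_v: "Re (v k) = s k - 1" for k
    by (simp add: v_def s_def of_rat_complex_eq)
  \<comment> \<open>All factors of the bound that do not depend on \<open>r\<close>.\<close>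
  define B where "B = exp (- (\<Sum>k = 1..d. Im (v k) * \<theta> k)) * exp C"
  have bound: "norm (A_integrand d n a \<beta> m y r \<theta>)
      \<le> B * (\<Prod>k = 1..d. r k powr (s k - 1) * exp (- \<epsilon> * r k))"
    if r: "\<forall>k\<in>{1..d}. r k > 0" for r
  proof -
    have "(\<Sum>k = 1..d. Re (rcis (r k) (\<theta> k))) \<le> (\<Sum>k = 1..d. - (2 * \<epsilon>) * r k)"
    proof (intro sum_mono)
      fix k assume k: "k \<in> {1..d}"
      have "2 * \<epsilon> * r k \<le> c k * r k"
        using \<epsilon>_le[OF k] r k by (intro mult_right_mono) (auto simp: less_imp_le)
      then show "Re (rcis (r k) (\<theta> k)) \<le> - (2 * \<epsilon>) * r k"
        by (simp add: \<theta>_def cos_cycle_arg c_def mult.commute)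
    qed
    also have "\<dots> = - (2 * \<epsilon>) * (\<Sum>k = 1..d. r k)"
      by (simp add: sum_distrib_left)
    finally have "Re ((\<Sum>k = 1..d. rcis (r k) (\<theta> k)) +
        (\<Sum>j = d+1..n-1. y j * cover_pow d r \<theta> (\<lambda>k. of_rat (a j k)))) \<le> C + (\<Sum>k = 1..d. - \<epsilon> * r k)"
      using C[OF r, of \<theta>] by (simp add: sum_negf flip: sum_distrib_left)
    then have "exp (Re ((\<Sum>k = 1..d. rcis (r k) (\<theta> k)) +
        (\<Sum>j = d+1..n-1. y j * cover_pow d r \<theta> (\<lambda>k. of_rat (a j k)))))
        \<le> exp C * (\<Prod>k = 1..d. exp (- \<epsilon> * r k))"
      unfolding exp_sum[OF finite_atLeastAtMost, symmetric] exp_add[symmetric] exp_le_cancel_iff .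
    then have "norm (cover_pow d r \<theta> v) * exp (Re ((\<Sum>k = 1..d. rcis (r k) (\<theta> k)) +
        (\<Sum>j = d+1..n-1. y j * cover_pow d r \<theta> (\<lambda>k. of_rat (a j k)))))
        \<le> norm (cover_pow d r \<theta> v) * (exp C * (\<Prod>k = 1..d. exp (- \<epsilon> * r k)))"
      by (intro mult_left_mono) auto
    also have "\<dots> = B * (\<Prod>k = 1..d. r k powr (s k - 1) * exp (- \<epsilon> * r k))"
      unfolding norm_cover_pow[OF r] Re_v B_def prod.distrib by simp
    finally show ?thesis
      unfolding A_integrand_def v_def[symmetric] norm_mult norm_exp_eq_Re .
  qed
  have "set_integrable (Pi\<^sub>M {1..d} (\<lambda>_. lborel)) (Pi\<^sub>E {1..d} (\<lambda>_. {0<..}))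
      (\<lambda>r. B * (\<Prod>k = 1..d. r k powr (s k - 1) * exp (- \<epsilon> * r k)))"
    using s_pos \<epsilon>_pos by (intro set_integrable_mult_right integrable_prod_Gamma_kernel) auto
  then show ?thesis
    unfolding cycle_integrable_def
  proof (rule set_integrable_bound[OF _ cycle_form_A_measurable])
    show "AE r in Pi\<^sub>M {1..d} (\<lambda>_. lborel). r \<in> Pi\<^sub>E {1..d} (\<lambda>_. {0<..}) \<longrightarrow>
        norm (cycle_form d p \<delta> (A_integrand d n a \<beta> m y) r)
        \<le> norm (B * (\<Prod>k = 1..d. r k powr (s k - 1) * exp (- \<epsilon> * r k)))"
    proof (intro AE_I2 impI)
      fix r :: "nat \<Rightarrow> real" assume "r \<in> Pi\<^sub>E {1..d} (\<lambda>_. {0<..})"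
      then have "norm (A_integrand d n a \<beta> m y r \<theta>)
          \<le> B * (\<Prod>k = 1..d. r k powr (s k - 1) * exp (- \<epsilon> * r k))"
        by (intro bound) (auto simp: PiE_def Pi_def)
      also have "\<dots> \<le> norm \<dots>" by simp
      finally show "norm (cycle_form d p \<delta> (A_integrand d n a \<beta> m y) r)
          \<le> norm (B * (\<Prod>k = 1..d. r k powr (s k - 1) * exp (- \<epsilon> * r k)))"
        unfolding norm_cycle_form \<theta>_def .
    qed
  qed
qed

section \<open>Sign of the real part of the last monomial on the sector\<close>

lemma cos_neg_if_Theta:
  assumes "x \<in> Theta"
  shows "cos x < 0"
proof -
  obtain l :: int where l: "pi/2 + 2 * pi * l < x" "x < 3 * pi/2 + 2 * pi * l"
    using assms by (auto simp: Theta_def)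
  define u where "u = x - 2 * pi * l - pi"
  have x: "x = (u + pi) + 2 * pi * l"
    by (simp add: u_def)
  have "cos x = cos (u + pi)"
    using sin_cos_eq_iff[of x "u + pi"] x by auto
  moreover have "cos u > 0"
    using l by (intro cos_gt_zero_pi) (auto simp: u_def)
  ultimately show ?thesis by simp
qed

text \<open>As \<open>r\<close> varies with fixed arguments, the product stays on one ray from 0,
  and membership in the sector says that the angle of this ray lies in \<open>Theta\<close>.\<close>

lemma Re_mult_cover_pow_neg:
  assumes "z \<in> sector d n a p \<delta>"
  shows "Re (z * cover_pow d r (cycle_arg p \<delta>) (\<lambda>k. of_rat (a n k))) < 0"
proof -
  \<comment> \<open>Being an exponential, \<open>R\<close> is positive for every real vector
    \<open>r\<close>, also outside the orthant.\<close>
  define R where "R = exp (\<Sum>k = 1..d. of_rat (a n k) * ln (r k))"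
  define x where "x = (\<Sum>k = 1..d. of_rat (a n k) * cycle_arg p \<delta> k)"
  have "cover_pow d r (cycle_arg p \<delta>) (\<lambda>k. of_rat (a n k)) = rcis R x"
    unfolding cover_pow_def
    by (simp add: complex_eq_iff Re_exp Im_exp R_def x_def of_rat_complex_eq)
  moreover have "z = rcis (norm z) (Arg z)"
    by (simp add: rcis_cmod_Arg)
  ultimately have eq: "z * cover_pow d r (cycle_arg p \<delta>) (\<lambda>k. of_rat (a n k)) =
      rcis (norm z * R) (Arg z + x)"
    by (metis rcis_mult)
  have "x = (\<Sum>k = 1..d. (1 + \<delta> k + 2 * of_int (p k)) * of_rat (a n k)) * pi"
    by (simp add: x_def cycle_arg_def sum_distrib_left sum_distrib_right mult_ac)
  then have "cos (Arg z + x) < 0" "z \<noteq> 0"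
    using assms by (auto simp: sector_def intro: cos_neg_if_Theta)
  then show ?thesis
    unfolding eq by (simp add: R_def mult_pos_neg)
qed

section \<open>Integration of the Taylor remainder over the cycle\<close>

theorem theorem4p7:
  fixes d n :: nat
    and a :: "nat \<Rightarrow> nat \<Rightarrow> rat"
    and \<beta> y' :: "nat \<Rightarrow> complex"
    and p :: "nat \<Rightarrow> int"
    and \<delta> :: "nat \<Rightarrow> real"
    and yn0 :: complex
  assumes "1 \<le> d" and "d < n"
    and "\<And>j k. j \<in> {1..d} \<Longrightarrow> k \<in> {1..d} \<Longrightarrow> a j k = (if j = k then 1 else 0)"
    and "\<And>j. j \<in> {d+1..n-1} \<Longrightarrow> (\<forall>k\<in>{1..d}. a j k > 0) \<and> weight d (a j) < 1"
    and "\<forall>k\<in>{1..d}. a n k > 0" and "weight d (a n) > 1"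
    and "\<And>k. k \<in> {1..d} \<Longrightarrow> Re (\<beta> k) < 0"
    and "yn0 \<noteq> 0"
    and "\<And>k. k \<in> {1..d} \<Longrightarrow> \<bar>\<delta> k\<bar> < 1/2"
    and "yn0 \<in> sector d n a p \<delta>"
  shows "(\<forall>yn \<in> sector d n a p \<delta>. cycle_integrable d p \<delta> (F_integrand d n a \<beta> (y'(n := yn)))) \<and>
    (\<forall>m. cycle_integrable d p \<delta> (A_integrand d n a \<beta> m y')) \<and>
    has_asymptotic_expansion (\<lambda>yn. F_int d n a p \<delta> \<beta> (y'(n := yn))) (sector d n a p \<delta>)
      (\<lambda>m. A_coeff d n a p \<delta> \<beta> m y')"
proof -
  define M where "M = Pi\<^sub>M {1..d} (\<lambda>_::nat. lborel :: real measure)"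
  define E where "E = Pi\<^sub>E {1..d} (\<lambda>_::nat. {0::real<..})"
  \<comment> \<open>With \<open>u\<close> for t^a(n) along the cycle and \<open>W\<close> for the
    integrand of the coefficient 0, the coefficients have integrand \<open>W * u ^ m\<close> and F
    has \<open>W * exp (z * u)\<close>.\<close>
  define u where "u r = cover_pow d r (cycle_arg p \<delta>) (\<lambda>k. of_rat (a n k))" for r
  define G where "G m = cycle_form d p \<delta> (A_integrand d n a \<beta> m y')" for m
  define W where "W = G 0"
  define H where "H z = cycle_form d p \<delta> (F_integrand d n a \<beta> (y'(n := z)))" for z
  have A_int: "cycle_integrable d p \<delta> (A_integrand d n a \<beta> m y')" for m
    using assms by (intro cycle_integrable_A) auto
  then have G_int: "set_integrable M E (G m)" for m
    by (simp add: cycle_integrable_def G_def M_def E_def)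
  have G_eq: "G m r = W r * u r ^ m" for m r
    unfolding W_def G_def cycle_form_def A_integrand_def cover_pow_add_mult u_def by simp
  have split: "{d+1..n} = insert n {d+1..n-1}"
    using \<open>d < n\<close> by auto
  have H_eq: "H z r = W r * exp (z * u r)" for z r
  proof -
    have "(\<Sum>j = d+1..n. (y'(n := z)) j * cover_pow d r (cycle_arg p \<delta>) (\<lambda>k. of_rat (a j k))) =
        z * u r + (\<Sum>j = d+1..n-1. y' j * cover_pow d r (cycle_arg p \<delta>) (\<lambda>k. of_rat (a j k)))"
      unfolding split using \<open>d < n\<close>
      by (subst sum.insert) (auto simp: u_def intro!: sum.cong)
    then show ?thesis
      unfolding H_def W_def G_def cycle_form_def A_integrand_def F_integrand_def
      by (simp add: exp_add)
  qed
  have Re_neg: "Re (z * u r) < 0" if "z \<in> sector d n a p \<delta>" for z r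
    using Re_mult_cover_pow_neg[OF that] by (simp add: u_def)
  \<comment> \<open>On the sector the extra factor \<open>exp (z * u r)\<close> has modulus at most
    1, so the integrand for m = 0 dominates.\<close>
  have H_int: "set_integrable M E (H z)" if "z \<in> sector d n a p \<delta>" for z
  proof (rule set_integrable_bound[OF G_int[of 0]])
    show "set_borel_measurable M E (H z)"
      unfolding M_def E_def H_def by (rule cycle_form_F_measurable)
    show "AE r in M. r \<in> E \<longrightarrow> norm (H z r) \<le> norm (G 0 r)"
    proof (intro AE_I2 impI)
      fix r
      have "exp (Re (z * u r)) \<le> 1"
        using Re_neg[OF that, of r] by simp
      then show "norm (H z r) \<le> norm (G 0 r)"
        unfolding H_eq W_def norm_mult norm_exp_eq_Re by (rule mult_left_le) simp
    qed
  qed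
  have remainder: "norm (H z r - (\<Sum>m<N. G m r * (z ^ m / fact m)))
      \<le> norm (G N r) * (norm z ^ N / fact (N - 1))" if z: "z \<in> sector d n a p \<delta>" and N: "N > 0" for z r N
  proof -
    have "H z r - (\<Sum>m<N. G m r * (z ^ m / fact m)) =
        W r * (exp (z * u r) - (\<Sum>m<N. (z * u r) ^ m / fact m))"
      unfolding H_eq G_eq
      by (simp add: sum_distrib_left right_diff_distrib power_mult_distrib mult_ac)
    then have "norm (H z r - (\<Sum>m<N. G m r * (z ^ m / fact m))) =
        norm (W r) * norm (exp (z * u r) - (\<Sum>m<N. (z * u r) ^ m / fact m))"
      by (simp add: norm_mult)
    also have "\<dots> \<le> norm (W r) * (norm (z * u r) ^ N / fact (N - 1))"
      using Re_neg[OF z] N by (intro mult_left_mono norm_exp_minus_Taylor_le) (auto intro: less_imp_le)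
    \<comment> \<open>The growth of \<open>u\<close> to the power N is absorbed into
      \<open>G N\<close>, which is integrable.\<close>
    also have "\<dots> = norm (G N r) * (norm z ^ N / fact (N - 1))"
      unfolding G_eq by (simp add: norm_mult norm_power power_mult_distrib mult_ac)
    finally show ?thesis .
  qed
  have "has_asymptotic_expansion (\<lambda>yn. F_int d n a p \<delta> \<beta> (y'(n := yn))) (sector d n a p \<delta>)
      (\<lambda>m. A_coeff d n a p \<delta> \<beta> m y')"
    unfolding has_asymptotic_expansion_def
  proof (intro allI impI)
    fix N :: nat assume N: "N > 0"
    \<comment> \<open>Independent of \<open>z\<close>, so the resulting constant serves the whole
      sector.\<close>
    define I where "I = (LINT r:E|M. norm (G N r))"
    have I_nonneg: "I \<ge> 0"
      unfolding I_def set_lebesgue_integral_def by (intro integral_nonneg_AE) auto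
    have "norm (F_int d n a p \<delta> \<beta> (y'(n := z)) -
        (\<Sum>m<N. A_coeff d n a p \<delta> \<beta> m y' * (z ^ m / fact m))) \<le> (I / fact (N - 1) + 1) * norm z ^ N"
      if z: "z \<in> sector d n a p \<delta>" for z
    proof -
      \<comment> \<open>Integrands cut off by the indicator, so that linearity of the ordinary
        integral applies.\<close>
      define g where "g m r = indicator E r *\<^sub>R G m r" for m r
      define h where "h r = indicator E r *\<^sub>R H z r" for r
      have g: "integrable M (g m)" and h: "integrable M h" for m
        using G_int[of m] H_int[OF z] by (simp_all add: set_integrable_def g_def h_def [abs_def] g_def [abs_def])
      have "F_int d n a p \<delta> \<beta> (y'(n := z)) - (\<Sum>m<N. A_coeff d n a p \<delta> \<beta> m y' * (z ^ m / fact m)) =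
          (LINT r|M. h r) - (\<Sum>m<N. (LINT r|M. g m r) * (z ^ m / fact m))"
        by (simp add: F_int_def A_coeff_def cycle_integral_def set_lebesgue_integral_def
            g_def h_def G_def H_def M_def E_def)
      also have "\<dots> = (LINT r|M. h r - (\<Sum>m<N. g m r * (z ^ m / fact m)))"
        using g h by (simp add: Bochner_Integration.integral_diff Bochner_Integration.integral_sum)
      also have "norm \<dots> \<le> (LINT r|M. norm (g N r) * (norm z ^ N / fact (N - 1)))"
      proof (rule order.trans[OF integral_norm_bound integral_mono])
        show "integrable M (\<lambda>r. norm (h r - (\<Sum>m<N. g m r * (z ^ m / fact m))))"
          using g h by (intro integrable_norm Bochner_Integration.integrable_diff Bochner_Integration.integrable_sum
              integrable_mult_left) auto
        show "integrable M (\<lambda>r. norm (g N r) * (norm z ^ N / fact (N - 1)))"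
          using g by (intro integrable_mult_left integrable_norm) auto
        show "norm (h r - (\<Sum>m<N. g m r * (z ^ m / fact m))) \<le> norm (g N r) * (norm z ^ N / fact (N - 1))" for r
          using remainder[OF z N, of r] by (cases "r \<in> E") (simp_all add: g_def h_def)
      qed
      also have "\<dots> = I * (norm z ^ N / fact (N - 1))"
        using g by (simp add: I_def set_lebesgue_integral_def g_def)
      \<comment> \<open>The summand 1 makes the constant strictly positive, as \<open>I\<close> is
        only shown to be nonnegative.\<close>
      also have "\<dots> \<le> (I / fact (N - 1) + 1) * norm z ^ N"
        by (simp add: algebra_simps)
      finally show ?thesis .
    qed
    moreover have "I / fact (N - 1) + 1 > 0"
      using I_nonneg by (simp add: add_nonneg_pos)
    ultimately show "\<exists>K>0. \<forall>z\<in>sector d n a p \<delta>. norm (F_int d n a p \<delta> \<beta> (y'(n := z)) -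
        (\<Sum>m<N. A_coeff d n a p \<delta> \<beta> m y' * (z ^ m / fact m))) \<le> K * norm z ^ N"
      by blast
  qed
  with A_int H_int show ?thesis
    by (simp add: cycle_integrable_def H_def M_def E_def)
qed

end
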